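(* Let $n\ge2$ and let $F\in S=\mathbb{C}[x_0,\dots,x_n]$ be a form of degree $d\ge2$ in $n+1$ variables. If $r\ge d+n$, then there exists a Hadamard star configuration $\mathbb{X}(H_1,\dots,H_r)$ of codimension $n$ in $\mathbb{P}(S_1)\cong\mathbb{P}^n$ which is apolar to $F$.
   Context: Let $S=\mathbb{C}[x_0,\dots,x_n]$ and $T=\mathbb{C}[y_0,\dots,y_n]$ with their standard gradings. $T$ acts on $S$ by differentiation, $y_j=\partial/\partial x_j$. For a form $F\in S$, $F^\perp=\{\partial\in T:\partial F=0\}$. A linear form $a_0x_0+\dots+a_nx_n\in S_1$ is regarded as the point $[a_0:\dots:a_n]\in\mathbb{P}(S_1)\cong\mathbb{P}^n$, and $T$ is the homogeneous coordinate ring of $\mathbb{P}(S_1)$. A finite set of points $\mathbb{X}\subset\mathbb{P}(S_1)$ with homogeneous ideal $I(\mathbb{X})\subset T$ is apolar to $F$ if $I(\mathbb{X})\subset F^\perp$. Hadamard product: for points $A=[a_0:\dots:a_n]$, $B=[b_0:\dots:b_n]$ with $a_ib_i\ne0$ for some $i$, $A\star B=[a_0b_0:\dots:a_nb_n]$ (otherwise it is not defined). For a point $P$ and a variety $X$, $P\star X$ is the closure of $\{P\star Q: Q\in X,\ P\star Q\text{ defined}\}$. A collection of linear forms $\mathcal{L}=\{L_1,\dots,L_r\}\subset T_1$ is generally linear if any $t\le n$ of them have common zero locus of dimension $n-t$ in $\mathbb{P}^n$ and any $t>n$ of them have empty common zero locus. For generally linear $\mathcal{L}$ and hyperplanes $H_i=V(L_i)$,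 the codimension $n$ star configuration is the set of points $\mathbb{X}(H_1,\dots,H_r)=\bigcup_{1\le i_1<\dots<i_n\le r}H_{i_1}\cap\dots\cap H_{i_n}$. It is a Hadamard star configuration (HSC) if $\mathcal{L}$ is a strong Hadamard set, i.e. there are a linear form $L$ and points $P_1,\dots,P_r\in V(L)$ with $V(L_i)=P_i\star V(L)$ for all $i$. *)

theory Defs
  imports "HOL-Analysis.Analysis" "HOL-Library.Poly_Mapping"
begin

section \<open>Polynomials and the differentiation action\<close>

text \<open>Both $S$ and $T$ are the complex polynomial ring whose variables are indexed by a finite type
  \<^typ>\<open>'n\<close> with $n + 1$ elements; the ring structure is the convolution one of
  \<^theory>\<open>HOL-Library.Poly_Mapping\<close>.\<close>

type_synonym 'n monomial = "'n \<Rightarrow>\<^sub>0 nat"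
type_synonym 'n mpoly = "'n monomial \<Rightarrow>\<^sub>0 complex"

text \<open>As an element of the graded piece of degree $d$, the zero polynomial is a form of every
  degree.\<close>

definition form :: "nat \<Rightarrow> ('n::finite) mpoly \<Rightarrow> bool" where
  "form d f \<longleftrightarrow> (\<forall>m \<in> Poly_Mapping.keys f. (\<Sum>j\<in>UNIV. Poly_Mapping.lookup m j) = d)"

definition peval :: "('n::finite) mpoly \<Rightarrow> complex ^ 'n \<Rightarrow> complex" where
  "peval f v =
     (\<Sum>m\<in>Poly_Mapping.keys f. Poly_Mapping.lookup f m * (\<Prod>j\<in>UNIV. v $ j ^ Poly_Mapping.lookup m j))"

text \<open>The truncated subtraction of exponents is harmless: the coefficient vanishes when $x_j$ does
  not occur in the monomial.\<close>

definition pdiff :: "'n \<Rightarrow> ('n::finite) mpoly \<Rightarrow> 'n mpoly" where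
  "pdiff j F = (\<Sum>m\<in>Poly_Mapping.keys F.
     Poly_Mapping.single (m - Poly_Mapping.single j 1)
       (of_nat (Poly_Mapping.lookup m j) * Poly_Mapping.lookup F m))"

lemma lookup_pdiff:
  "Poly_Mapping.lookup (pdiff j F) m =
     of_nat (Poly_Mapping.lookup m j + 1) * Poly_Mapping.lookup F (m + Poly_Mapping.single j 1)"
proof -
  let ?e = "Poly_Mapping.single j (1::nat)"
  have *: "Poly_Mapping.lookup (Poly_Mapping.single (k - ?e)
             (of_nat (Poly_Mapping.lookup k j) * Poly_Mapping.lookup F k)) m =
           (if k = m + ?e then of_nat (Poly_Mapping.lookup m j + 1) * Poly_Mapping.lookup F (m + ?e)
            else 0)" for k
  proof (cases "Poly_Mapping.lookup k j = 0")
    case True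
    then show ?thesis
      by (auto simp: lookup_add lookup_single)
  next
    case False
    then have "k - ?e + ?e = k"
      by (intro poly_mapping_eqI) (auto simp: lookup_add lookup_minus lookup_single when_def)
    then have "k - ?e = m \<longleftrightarrow> k = m + ?e"
      by auto
    then show ?thesis
      by (auto simp: lookup_single lookup_add when_def)
  qed
  have "Poly_Mapping.lookup (pdiff j F) m = (\<Sum>k\<in>Poly_Mapping.keys F.
      if k = m + ?e then of_nat (Poly_Mapping.lookup m j + 1) * Poly_Mapping.lookup F (m + ?e) else 0)"
    unfolding pdiff_def lookup_sum by (intro sum.cong refl *)
  then show ?thesis
    by (auto simp: sum.delta' in_keys_iff)
qed

lemma pdiff_commute: "pdiff i (pdiff j F) = pdiff j (pdiff i F)"
  by (rule poly_mapping_eqI)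
    (auto simp: lookup_pdiff lookup_add lookup_single when_def algebra_simps)

text \<open>A monomial operator is the composition, in any order, of the powers of the partial
  derivatives.\<close>

definition diff_monomial :: "('n::finite) monomial \<Rightarrow> 'n mpoly \<Rightarrow> 'n mpoly" where
  "diff_monomial m F = Finite_Set.fold (\<lambda>j. pdiff j ^^ Poly_Mapping.lookup m j) F UNIV"

lemma comp_fun_commute_pdiff:
  "comp_fun_commute (\<lambda>j. pdiff j ^^ Poly_Mapping.lookup m j)"
proof
  fix i j :: 'a
  have 1: "pdiff i ((pdiff j ^^ k) F) = (pdiff j ^^ k) (pdiff i F)" for i j :: 'a and k F
    by (induction k) (simp_all add: pdiff_commute[of i j])
  have "(pdiff i ^^ k) ((pdiff j ^^ l) F) = (pdiff j ^^ l) ((pdiff i ^^ k) F)" for k l F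
    by (induction k) (auto simp: 1)
  then show "(pdiff j ^^ Poly_Mapping.lookup m j) \<circ> (pdiff i ^^ Poly_Mapping.lookup m i) =
      (pdiff i ^^ Poly_Mapping.lookup m i) \<circ> (pdiff j ^^ Poly_Mapping.lookup m j)"
    by auto
qed

text \<open>In the factor \<open>Poly_Mapping.single 0 c\<close> a coefficient \<open>c\<close> is viewed as a constant polynomial.\<close>

definition diff_action :: "('n::finite) mpoly \<Rightarrow> 'n mpoly \<Rightarrow> 'n mpoly" where
  "diff_action D F = (\<Sum>m\<in>Poly_Mapping.keys D.
     Poly_Mapping.single 0 (Poly_Mapping.lookup D m) * diff_monomial m F)"

definition perp :: "('n::finite) mpoly \<Rightarrow> 'n mpoly set" where
  "perp F = {D. diff_action D F = 0}"


section \<open>Projective space\<close>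

text \<open>Points of $\mathbb{P}(S_1)$ are the one-dimensional subspaces of $\mathbb{C}^{n+1}$, a linear
  form $\sum_j a_j x_j$ being identified with its coefficient vector $a$.\<close>

definition proj_points :: "(complex ^ 'n) set set" where
  "proj_points = {P. vec.subspace P \<and> vec.dim P = 1}"

definition vanishes_at :: "('n::finite) mpoly \<Rightarrow> (complex ^ 'n) set \<Rightarrow> bool" where
  "vanishes_at f P \<longleftrightarrow> (\<forall>v\<in>P. peval f v = 0)"

definition zero_locus :: "('n::finite) mpoly set \<Rightarrow> (complex ^ 'n) set set" where
  "zero_locus G = {P \<in> proj_points. \<forall>g\<in>G. vanishes_at g P}"

definition zariski_closed :: "(complex ^ 'n::finite) set set \<Rightarrow> bool" where
  "zariski_closed Z \<longleftrightarrow> (\<exists>G. (\<forall>g\<in>G. \<exists>d. form d g) \<and> Z = zero_locus G)"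

text \<open>The module of \<open>times\<close> is the ring as a module over itself, so its span is the generated
  ideal.\<close>

definition vanishing_ideal :: "(complex ^ 'n::finite) set set \<Rightarrow> 'n mpoly set" where
  "vanishing_ideal X =
     module.span times {f. (\<exists>d. form d f) \<and> (\<forall>P\<in>X. vanishes_at f P)}"

lemma module_times: "module (times :: 'a::comm_ring_1 \<Rightarrow> 'a \<Rightarrow> 'a)"
  by standard (auto simp: algebra_simps)

definition apolar :: "(complex ^ 'n::finite) set set \<Rightarrow> 'n mpoly \<Rightarrow> bool" where
  "apolar X F \<longleftrightarrow> finite X \<and> X \<subseteq> proj_points \<and> vanishing_ideal X \<subseteq> perp F"

text \<open>For a linear subspace \<open>Z\<close> of projective space, \<open>\<Union>Z\<close> is the corresponding vector subspace; the
  empty locus has dimension $-1$.\<close>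

definition linear_dim :: "(complex ^ 'n::finite) set set \<Rightarrow> int" where
  "linear_dim Z = int (vec.dim (\<Union>Z)) - 1"


section \<open>Hadamard products\<close>

definition hadamard_defined :: "(complex ^ 'n) set \<Rightarrow> (complex ^ 'n) set \<Rightarrow> bool" where
  "hadamard_defined A B \<longleftrightarrow> (\<exists>a\<in>A. \<exists>b\<in>B. \<exists>i. a $ i * b $ i \<noteq> 0)"

text \<open>The product of vectors is componentwise. If \<open>A\<close> and \<open>B\<close> are the lines spanned by \<open>a\<close> and \<open>b\<close>,
  this is the line spanned by \<open>a * b\<close> whenever the product is defined.\<close>

definition hadamard_point :: "(complex ^ 'n) set \<Rightarrow> (complex ^ 'n) set \<Rightarrow> (complex ^ 'n) set" where
  "hadamard_point A B = {a * b | a b. a \<in> A \<and> b \<in> B}"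

definition hadamard_variety ::
    "(complex ^ 'n::finite) set \<Rightarrow> (complex ^ 'n) set set \<Rightarrow> (complex ^ 'n) set set" where
  "hadamard_variety P X =
     zariski_closed hull {hadamard_point P Q | Q. Q \<in> X \<and> hadamard_defined P Q}"


section \<open>Hadamard star configurations\<close>

text \<open>A collection $L_1, \dots, L_r$ is given by the values of a function on \<open>{1..r}\<close>. The dimension
  $n$ of the projective space is \<^term>\<open>CARD('n) - 1\<close>.\<close>

definition generally_linear :: "nat \<Rightarrow> (nat \<Rightarrow> ('n::finite) mpoly) \<Rightarrow> bool" where
  "generally_linear r L \<longleftrightarrow>
     (\<forall>i\<in>{1..r}. form 1 (L i)) \<and>
     (\<forall>J\<subseteq>{1..r}.
        (card J \<le> CARD('n) - 1 \<longrightarrow>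
           linear_dim (zero_locus (L ` J)) = int (CARD('n) - 1) - int (card J)) \<and>
        (card J > CARD('n) - 1 \<longrightarrow> zero_locus (L ` J) = {}))"

text \<open>The linear form defining the common hyperplane is required to be nonzero.\<close>

definition strong_hadamard :: "nat \<Rightarrow> (nat \<Rightarrow> ('n::finite) mpoly) \<Rightarrow> bool" where
  "strong_hadamard r L \<longleftrightarrow>
     (\<exists>M P. form 1 M \<and> M \<noteq> 0 \<and>
        (\<forall>i\<in>{1..r}. P i \<in> zero_locus {M} \<and>
           zero_locus {L i} = hadamard_variety (P i) (zero_locus {M})))"

definition star_configuration ::
    "nat \<Rightarrow> (nat \<Rightarrow> (complex ^ 'n::finite) set set) \<Rightarrow> (complex ^ 'n) set set" where
  "star_configuration r H = (\<Union>J\<in>{J. J \<subseteq> {1..r} \<and> card J = CARD('n) - 1}. \<Inter>i\<in>J. H i)"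

definition hadamard_star_configuration :: "nat \<Rightarrow> (complex ^ 'n::finite) set set \<Rightarrow> bool" where
  "hadamard_star_configuration r X \<longleftrightarrow>
     (\<exists>L. generally_linear r L \<and> strong_hadamard r L \<and>
        X = star_configuration r (\<lambda>i. zero_locus {L i}))"

end

theory Submission
  imports Defs "HOL-Computational_Algebra.Fundamental_Theorem_Algebra"
begin

text \<open>
  The point is that, for $r$ large, the ideal of a star configuration of $r$ hyperplanes starts in
  a degree so high that apolarity becomes automatic: a nonzero form vanishing on a codimension
  $n$ star configuration of $r$ general hyperplanes in $\mathbb{P}^n$ has degree at least
  $r - n + 1$. When $r \ge d + n$ this exceeds $d$, and every differential operator of order
  greater than $d$ kills $F$. Hence any Hadamard star configuration of $r$ hyperplanes is apolar
  to $F$, and what remains is to exhibit one.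

  Everything becomes transparent after choosing distinct nodes $a_0, \dots, a_n$ and identifying a
  vector of $\mathbb{C}^{n+1}$ with the polynomial in one variable $x$ of degree at most $n$ that
  takes its entries as values at the nodes. The componentwise product is then the product of
  polynomials, as long as the degree stays at most $n$. Choose further distinct numbers
  $s_1, \dots, s_r$, none of them a node.

  \<^item> The hyperplane $V(M)$ of the strong Hadamard set consists of the polynomials of degree less
    than $n$, that is, $M$ is the coefficient of $x^n$. It contains the points $P_i = x - s_i$
    because $n \ge 2$.

  \<^item> The multiples of $x - s_i$ of degree at most $n$ are the products of $x - s_i$ with an
    element of $V(M)$, so $P_i \star V(M) = V(L_i)$ where $L_i$ is evaluation at $s_i$
    (\<open>zero_locus_evaluation_form_eq_hadamard\<close>).

  \<^item> General linearity says that prescribing $t$ of the roots $s_i$ imposes $t$ independent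
    conditions on polynomials of degree at most $n$
    (\<open>generally_linear_evaluation_forms\<close>).

  \<^item> The points of the star configuration are the products $\prod_{i \in J} (x - s_i)$ with
    $|J| = n$. If a form of degree $e \le r - n$ vanishes there, the prescribed roots can be set
    free one at a time: with all factors but one held fixed, the form is a polynomial of degree at
    most $e$ in the remaining root, and it vanishes whenever this root is one of the more than $e$
    unused $s_i$, hence always. By the fundamental theorem of algebra the form then vanishes
    everywhere (\<open>form_vanishing_on_star\<close>).
\<close>

section \<open>Forms and differential operators\<close>

lemma peval_superset:
  fixes f :: "('n::finite) mpoly"
  assumes "finite A" "Poly_Mapping.keys f \<subseteq> A"
  shows "peval f v =
    (\<Sum>m\<in>A. Poly_Mapping.lookup f m * (\<Prod>j\<in>UNIV. v $ j ^ Poly_Mapping.lookup m j))"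
  unfolding peval_def
  by (rule sum.mono_neutral_left) (use assms in \<open>auto simp: in_keys_iff\<close>)

definition linear_mpoly :: "('n::finite \<Rightarrow> complex) \<Rightarrow> 'n mpoly" where
  "linear_mpoly c = (\<Sum>j\<in>UNIV. Poly_Mapping.single (Poly_Mapping.single j 1) (c j))"

lemma keys_linear_mpoly:
  "Poly_Mapping.keys (linear_mpoly c) \<subseteq> range (\<lambda>j. Poly_Mapping.single j 1)"
  unfolding linear_mpoly_def by (rule order_trans[OF Poly_Mapping.keys_sum]) auto

lemma lookup_linear_mpoly:
  "Poly_Mapping.lookup (linear_mpoly c) (Poly_Mapping.single j 1) = c j"
proof -
  have eq: "Poly_Mapping.single i (1::nat) = Poly_Mapping.single j 1 \<longleftrightarrow> i = j" for i :: 'a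
    by (metis lookup_single_eq lookup_single_not_eq zero_neq_one)
  show ?thesis
    unfolding linear_mpoly_def lookup_sum lookup_single eq by (simp add: when_def)
qed

lemma form_linear_mpoly: "form 1 (linear_mpoly c)"
  unfolding form_def using keys_linear_mpoly[of c] by (auto simp: lookup_single when_def)

lemma peval_linear_mpoly: "peval (linear_mpoly c) v = (\<Sum>j\<in>UNIV. c j * v $ j)"
proof -
  have inj: "inj (\<lambda>j::'a. Poly_Mapping.single j (1::nat))"
    by (rule injI) (metis lookup_single_eq lookup_single_not_eq zero_neq_one)
  have "(\<Prod>k\<in>UNIV. v $ k ^ Poly_Mapping.lookup (Poly_Mapping.single j 1) k) = v $ j" for j
    by (simp add: lookup_single when_def if_distrib[of "power _"] cong: if_cong)
  then show ?thesis
    using inj by (simp add: peval_superset[OF _ keys_linear_mpoly] sum.reindex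
        lookup_linear_mpoly[unfolded One_nat_def])
qed

lemma peval_along_line:
  fixes f :: "('n::finite) mpoly"
  assumes "form e f"
  obtains p where "degree p \<le> e" "\<And>t. poly p t = peval f (v + t *s u)"
proof
  let ?p = "\<Sum>m\<in>Poly_Mapping.keys f. smult (Poly_Mapping.lookup f m)
      (\<Prod>j\<in>UNIV. [:v $ j, u $ j:] ^ Poly_Mapping.lookup m j)"
  show "poly ?p t = peval f (v + t *s u)" for t
    by (simp add: peval_def poly_sum poly_prod)
  have "degree (\<Prod>j\<in>UNIV. [:v $ j, u $ j:] ^ Poly_Mapping.lookup m j) \<le> e"
    if "m \<in> Poly_Mapping.keys f" for m
  proof -
    have "degree (\<Prod>j\<in>UNIV. [:v $ j, u $ j:] ^ Poly_Mapping.lookup m j)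
        \<le> (\<Sum>j\<in>UNIV. degree ([:v $ j, u $ j:] ^ Poly_Mapping.lookup m j))"
      using degree_prod_sum_le[of UNIV "\<lambda>j. [:v $ j, u $ j:] ^ Poly_Mapping.lookup m j"]
      by (simp add: o_def)
    also have "\<dots> \<le> (\<Sum>j\<in>UNIV. Poly_Mapping.lookup m j)"
      by (intro sum_mono order_trans[OF degree_power_le]) auto
    also have "\<dots> = e"
      using assms that by (auto simp: form_def)
    finally show ?thesis .
  qed
  then show "degree ?p \<le> e"
    by (intro degree_sum_le) (auto intro: order_trans[OF degree_smult_le])
qed

text \<open>On a line in $\mathbb{C}^{n+1}$ a form of degree $e$ is a polynomial of degree at most $e$ in the
  parameter, so more than $e$ zeros force it to vanish on the whole line.\<close>

lemma peval_zero_from_pencil: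
  fixes f :: "('n::finite) mpoly"
  assumes "form e f" "finite T" "e < card T" "\<And>t. t \<in> T \<Longrightarrow> peval f (v + t *s u) = 0"
  shows "peval f (v + z *s u) = 0"
proof -
  obtain p where p: "degree p \<le> e" "\<And>t. poly p t = peval f (v + t *s u)"
    using peval_along_line[OF assms(1)] by blast
  have "p = 0"
    by (rule poly_eqI_degree[of T]) (use p assms in auto)
  with p(2)[of z] show ?thesis by simp
qed

text \<open>The inductive form of the statement that a polynomial function determines the polynomial: one
  variable at a time is read off by comparing coefficients, which splits the index set \<open>K\<close>
  according to the exponent of that variable. The sum over all monomials of \<open>K\<close> that agree with
  \<open>k\<close> on \<open>A\<close> appears because distinct monomials may agree there; for \<open>A = UNIV\<close> it is a single
  coefficient.\<close>

lemma peval_coeff_sums_eq_0: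
  fixes c :: "('n::finite) monomial \<Rightarrow> complex"
  assumes "finite A" "finite K"
    and "\<And>v::complex^'n. (\<Sum>m\<in>K. c m * (\<Prod>j\<in>A. v $ j ^ Poly_Mapping.lookup m j)) = 0"
  shows "(\<Sum>m\<in>{m\<in>K. \<forall>j\<in>A. Poly_Mapping.lookup m j = Poly_Mapping.lookup k j}. c m) = 0"
  using assms
proof (induction A arbitrary: K rule: finite_induct)
  case empty
  then show ?case by simp
next
  case (insert x A)
  let ?K = "{m\<in>K. Poly_Mapping.lookup m x = Poly_Mapping.lookup k x}"
  have "(\<Sum>m\<in>?K. c m * (\<Prod>j\<in>A. v $ j ^ Poly_Mapping.lookup m j)) = 0" for v :: "complex^'n"
  proof -
    let ?P = "\<lambda>m. \<Prod>j\<in>A. v $ j ^ Poly_Mapping.lookup m j"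
    let ?p = "\<Sum>m\<in>K. monom (c m * ?P m) (Poly_Mapping.lookup m x)"
    have "poly ?p t = 0" for t
    proof -
      define w where "w = (\<chi> j. if j = x then t else v $ j)"
      have "(\<Prod>j\<in>insert x A. w $ j ^ Poly_Mapping.lookup m j)
          = t ^ Poly_Mapping.lookup m x * ?P m" for m
      proof -
        have "(\<Prod>j\<in>A. w $ j ^ Poly_Mapping.lookup m j) = ?P m"
          using insert.hyps by (intro prod.cong) (auto simp: w_def)
        then show ?thesis using insert.hyps by (simp add: w_def)
      qed
      with insert.prems(2)[of w] show ?thesis
        by (simp add: poly_sum poly_monom mult_ac)
    qed
    then have "?p = 0" by (simp add: poly_eq_poly_eq_iff[symmetric] fun_eq_iff)
    then have "coeff ?p (Poly_Mapping.lookup k x) = 0" by simp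
    then show ?thesis
      using insert.prems(1) by (simp add: coeff_sum sum.If_cases Int_def)
  qed
  from insert.IH[OF _ this] insert.prems(1) show ?case
    by (simp add: conj_ac)
qed

lemma peval_eq_0_imp_eq_0:
  fixes f :: "('n::finite) mpoly"
  assumes "\<And>v. peval f v = 0"
  shows "f = 0"
proof (rule poly_mapping_eqI)
  fix k
  have "(\<forall>j\<in>UNIV. Poly_Mapping.lookup m j = Poly_Mapping.lookup k j) \<longleftrightarrow> m = k" for m :: "'n monomial"
    by (metis UNIV_I poly_mapping_eqI)
  then have "{m\<in>Poly_Mapping.keys f. \<forall>j\<in>UNIV. Poly_Mapping.lookup m j = Poly_Mapping.lookup k j}
      = (if k \<in> Poly_Mapping.keys f then {k} else {})"
    by auto
  moreover have "(\<Sum>m\<in>{m\<in>Poly_Mapping.keys f. \<forall>j\<in>UNIV. Poly_Mapping.lookup m j = Poly_Mapping.lookup k j}.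
      Poly_Mapping.lookup f m) = 0"
    by (rule peval_coeff_sums_eq_0) (use assms in \<open>auto simp: peval_def\<close>)
  ultimately show "Poly_Mapping.lookup f k = Poly_Mapping.lookup 0 k"
    by (auto simp: in_keys_iff split: if_splits)
qed

lemma keys_pdiff_power:
  assumes "m \<in> Poly_Mapping.keys ((pdiff j ^^ k) F)"
  shows "m + Poly_Mapping.single j k \<in> Poly_Mapping.keys F"
  using assms
proof (induction k arbitrary: m)
  case 0
  then show ?case by simp
next
  case (Suc k)
  then have "m + Poly_Mapping.single j 1 \<in> Poly_Mapping.keys ((pdiff j ^^ k) F)"
    by (auto simp: in_keys_iff lookup_pdiff)
  from Suc.IH[OF this] show ?case
    by (simp add: add.assoc single_add[symmetric])
qed

lemma keys_fold_pdiff: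
  assumes "finite A"
    and "k \<in> Poly_Mapping.keys (Finite_Set.fold (\<lambda>j. pdiff j ^^ Poly_Mapping.lookup m j) F A)"
  shows "k + (\<Sum>j\<in>A. Poly_Mapping.single j (Poly_Mapping.lookup m j)) \<in> Poly_Mapping.keys F"
  using assms
proof (induction A arbitrary: k rule: finite_induct)
  case empty
  then show ?case by simp
next
  case (insert x A)
  have "Finite_Set.fold (\<lambda>j. pdiff j ^^ Poly_Mapping.lookup m j) F (insert x A) =
      (pdiff x ^^ Poly_Mapping.lookup m x)
        (Finite_Set.fold (\<lambda>j. pdiff j ^^ Poly_Mapping.lookup m j) F A)"
    by (rule comp_fun_commute_on.fold_insert[OF
          comp_fun_commute_pdiff[unfolded comp_fun_commute_def']])
       (use insert.hyps in auto)
  with insert.prems have "k + Poly_Mapping.single x (Poly_Mapping.lookup m x) \<in> Poly_Mapping.keys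
      (Finite_Set.fold (\<lambda>j. pdiff j ^^ Poly_Mapping.lookup m j) F A)"
    by (simp add: keys_pdiff_power)
  from insert.IH[OF this] insert.hyps show ?case by (simp add: add_ac)
qed

lemma diff_monomial_eq_0:
  fixes F :: "('n::finite) mpoly"
  assumes "form d F" "d < (\<Sum>j\<in>UNIV. Poly_Mapping.lookup m j)"
  shows "diff_monomial m F = 0"
proof -
  have "k \<notin> Poly_Mapping.keys (diff_monomial m F)" for k
  proof
    assume "k \<in> Poly_Mapping.keys (diff_monomial m F)"
    then have "k + (\<Sum>j\<in>UNIV. Poly_Mapping.single j (Poly_Mapping.lookup m j))
        \<in> Poly_Mapping.keys F"
      unfolding diff_monomial_def by (intro keys_fold_pdiff) auto
    moreover have "(\<Sum>j\<in>UNIV. Poly_Mapping.single j (Poly_Mapping.lookup m j)) = m"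
      by (rule poly_mapping_eqI) (simp add: lookup_sum lookup_single when_def)
    ultimately have "(\<Sum>j\<in>UNIV. Poly_Mapping.lookup (k + m) j) = d"
      using assms(1) by (auto simp: form_def)
    with assms(2) show False by (simp add: lookup_add sum.distrib)
  qed
  then show ?thesis by (metis keys_eq_empty ex_in_conv)
qed

lemma high_order_in_perp:
  fixes F D :: "('n::finite) mpoly"
  assumes "form d F"
    and "\<And>m. m \<in> Poly_Mapping.keys D \<Longrightarrow> d < (\<Sum>j\<in>UNIV. Poly_Mapping.lookup m j)"
  shows "D \<in> perp F"
  using assms by (simp add: perp_def diff_action_def diff_monomial_eq_0)

text \<open>Vanishing in degrees up to \<open>d\<close> passes from the forms in the ideal to the whole ideal: the
  polynomials all of whose monomials have degree greater than \<open>d\<close> are closed under sums and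
  multiples, and as operators they are of too high order not to kill \<open>F\<close>.\<close>

lemma vanishing_ideal_subset_perp:
  fixes F :: "('n::finite) mpoly"
  assumes "form d F"
    and low: "\<And>e f. form e f \<Longrightarrow> (\<forall>P\<in>X. vanishes_at f P) \<Longrightarrow> e \<le> d \<Longrightarrow> f = 0"
  shows "vanishing_ideal X \<subseteq> perp F"
proof
  interpret module "times :: 'n mpoly \<Rightarrow> _ \<Rightarrow> _" by (rule module_times)
  let ?H = "{D :: 'n mpoly. \<forall>m\<in>Poly_Mapping.keys D. d < (\<Sum>j\<in>UNIV. Poly_Mapping.lookup m j)}"
  fix D assume "D \<in> vanishing_ideal X"
  moreover have "span {f. (\<exists>e. form e f) \<and> (\<forall>P\<in>X. vanishes_at f P)} \<subseteq> ?H"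
  proof (rule span_minimal)
    show "{f. (\<exists>e. form e f) \<and> (\<forall>P\<in>X. vanishes_at f P)} \<subseteq> ?H"
    proof clarify
      fix f :: "'n mpoly" and e m
      assume f: "form e f" "\<forall>P\<in>X. vanishes_at f P" and m: "m \<in> Poly_Mapping.keys f"
      then have "\<not> e \<le> d" using low by fastforce
      with f(1) m show "d < (\<Sum>j\<in>UNIV. Poly_Mapping.lookup m j)" by (auto simp: form_def)
    qed
    show "subspace ?H"
    proof (rule subspaceI; clarsimp)
      fix p q :: "'n mpoly" and m
      assume "\<forall>m\<in>Poly_Mapping.keys p. d < (\<Sum>j\<in>UNIV. Poly_Mapping.lookup m j)"
        "\<forall>m\<in>Poly_Mapping.keys q. d < (\<Sum>j\<in>UNIV. Poly_Mapping.lookup m j)"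
        "m \<in> Poly_Mapping.keys (p + q)"
      then show "d < (\<Sum>j\<in>UNIV. Poly_Mapping.lookup m j)"
        using Poly_Mapping.keys_add[of p q] by blast
    next
      fix p q :: "'n mpoly" and m
      assume q: "\<forall>m\<in>Poly_Mapping.keys q. d < (\<Sum>j\<in>UNIV. Poly_Mapping.lookup m j)"
        and "m \<in> Poly_Mapping.keys (p * q)"
      then obtain a b where "m = a + b" "b \<in> Poly_Mapping.keys q"
        using Poly_Mapping.keys_mult[of p q] by blast
      with q show "d < (\<Sum>j\<in>UNIV. Poly_Mapping.lookup m j)"
        by (simp add: lookup_add sum.distrib trans_less_add2)
    qed
  qed
  ultimately have "D \<in> ?H" unfolding vanishing_ideal_def by blast
  then show "D \<in> perp F" using high_order_in_perp[OF assms(1)] by simp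
qed

section \<open>Lines and linear subspaces\<close>

lemma proj_point_span: "v \<noteq> 0 \<Longrightarrow> vec.span {v} \<in> (proj_points :: (complex ^ 'n::finite) set set)"
  by (simp add: proj_points_def)

lemma proj_point_eq_span:
  fixes v :: "complex ^ 'n::finite"
  assumes "P \<in> proj_points" "v \<in> P" "v \<noteq> 0"
  shows "P = vec.span {v}"
proof (rule vec.subspace_dim_equal[symmetric])
  show "vec.span {v} \<subseteq> P"
    using assms by (intro vec.span_minimal) (auto simp: proj_points_def)
qed (use assms in \<open>auto simp: proj_points_def\<close>)

lemma proj_pointE:
  fixes P :: "(complex ^ 'n::finite) set"
  assumes "P \<in> proj_points"
  obtains v where "v \<noteq> 0" "v \<in> P" "P = vec.span {v}"
proof -
  have "\<not> P \<subseteq> {0}" using assms by (auto simp: proj_points_def simp flip: vec.dim_eq_0)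
  then obtain v where "v \<in> P" "v \<noteq> 0" by blast
  with proj_point_eq_span[OF assms] that show thesis by blast
qed

text \<open>Any \<open>w\<close> in \<open>W\<close> differs from a multiple of \<open>u\<close> by an element of the kernel, so one vector
  completes the kernel to \<open>W\<close>.\<close>

lemma dim_hyperplane_section:
  fixes W :: "(complex ^ 'n::finite) set" and \<phi> :: "complex ^ 'n \<Rightarrow> complex"
  assumes W: "vec.subspace W" and u: "u \<in> W" "\<phi> u \<noteq> 0"
    and add: "\<And>v w. \<phi> (v + w) = \<phi> v + \<phi> w" and scale: "\<And>c v. \<phi> (c *s v) = c * \<phi> v"
  shows "vec.dim W = vec.dim {v\<in>W. \<phi> v = 0} + 1"
proof -
  let ?K = "{v\<in>W. \<phi> v = 0}"
  have \<phi>0: "\<phi> 0 = 0" using scale[of 0 0] by simp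
  have K: "vec.subspace ?K"
    using W \<phi>0 by (auto simp: vec.subspace_def add scale)
  have "W \<subseteq> vec.span (insert u ?K)"
  proof
    fix w assume w: "w \<in> W"
    have "\<phi> (w - (\<phi> w / \<phi> u) *s u) = 0"
      using add[of "w - (\<phi> w / \<phi> u) *s u" "(\<phi> w / \<phi> u) *s u"] u by (simp add: scale)
    then have "w - (\<phi> w / \<phi> u) *s u \<in> vec.span ?K"
      using W w u by (intro vec.span_base) (auto intro!: vec.subspace_diff vec.subspace_scale)
    then show "w \<in> vec.span (insert u ?K)" by (auto simp: vec.span_breakdown_eq)
  qed
  moreover have "vec.span (insert u ?K) \<subseteq> W"
    using W u by (intro vec.span_minimal) auto
  ultimately have "vec.dim W = vec.dim (insert u ?K)"
    by (metis subset_antisym vec.dim_span)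
  moreover have "u \<notin> vec.span ?K" using K u by (simp add: vec.span_eq_iff[THEN iffD2])
  ultimately show ?thesis by (simp add: vec.dim_insert)
qed


lemma vanishes_at_linear_mpoly:
  "vanishes_at (linear_mpoly c) (vec.span {v}) \<longleftrightarrow> peval (linear_mpoly c) v = 0"
proof -
  have "peval (linear_mpoly c) (k *s v) = k * peval (linear_mpoly c) v" for k
    by (simp add: peval_linear_mpoly sum_distrib_left mult_ac)
  then show ?thesis
    unfolding vanishes_at_def vec.span_singleton by (auto dest: spec[of _ 1])
qed

section \<open>Vectors as polynomials given by their values\<close>

text \<open>The coordinates are thought of as the values at the nodes \<open>a j\<close> of a polynomial in one variable
  of degree at most \<open>n\<close>; the numbers \<open>s i\<close> give the hyperplanes. Disjointness from the nodes
  makes all coordinates of the point belonging to $x - s_i$ nonzero, so that multiplying with it is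
  invertible.\<close>

locale interpolation_model =
  fixes a :: "'n::finite \<Rightarrow> complex" and s :: "nat \<Rightarrow> complex" and n :: nat
  assumes card_coords: "CARD('n) = n + 1"
    and inj_a: "inj a" and inj_s: "inj s" and s_neq_a: "s i \<noteq> a j"
begin

definition lagrange_basis :: "'n \<Rightarrow> complex poly" where
  "lagrange_basis j =
     smult (1 / (\<Prod>k\<in>UNIV - {j}. a j - a k)) (\<Prod>k\<in>UNIV - {j}. [:- a k, 1:])"

definition interpolant :: "complex ^ 'n \<Rightarrow> complex poly" where
  "interpolant v = (\<Sum>j\<in>UNIV. smult (v $ j) (lagrange_basis j))"

definition node_values :: "complex poly \<Rightarrow> complex ^ 'n" where
  "node_values g = (\<chi> j. poly g (a j))"

lemma node_values_mult: "node_values (g * h) = node_values g * node_values h"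
  by (simp add: node_values_def vec_eq_iff)

lemma node_values_add: "node_values (g + h) = node_values g + node_values h"
  by (simp add: node_values_def vec_eq_iff)

lemma node_values_smult: "node_values (smult c g) = c *s node_values g"
  by (simp add: node_values_def vec_eq_iff)

lemma degree_lagrange_basis: "degree (lagrange_basis j) \<le> n"
proof -
  have "degree (\<Prod>k\<in>UNIV - {j}. [:- a k, 1:]) = n"
    using card_coords by (subst degree_prod_sum_eq) auto
  then show ?thesis
    unfolding lagrange_basis_def by (metis degree_smult_le)
qed

lemma degree_interpolant: "degree (interpolant v) \<le> n"
  unfolding interpolant_def
  by (rule degree_sum_le) (auto intro: order_trans[OF degree_smult_le] degree_lagrange_basis)

lemma poly_lagrange_basis: "poly (lagrange_basis j) (a k) = (if k = j then 1 else 0)"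
proof (cases "k = j")
  case True
  have "(\<Prod>k\<in>UNIV - {j}. a j - a k) \<noteq> 0"
    using inj_a by (auto simp: inj_eq)
  with True show ?thesis by (simp add: lagrange_basis_def poly_prod)
next
  case False
  then have "(\<Prod>i\<in>UNIV - {j}. a k - a i) = 0"
    by (intro prod_zero) auto
  with False show ?thesis by (simp add: lagrange_basis_def poly_prod)
qed

lemma node_values_interpolant [simp]: "node_values (interpolant v) = v"
  by (simp add: node_values_def interpolant_def poly_sum poly_lagrange_basis vec_eq_iff
      if_distrib[of "(*) _"] cong: if_cong)

lemma interpolant_node_values [simp]:
  assumes "degree g \<le> n"
  shows "interpolant (node_values g) = g"
proof (rule poly_eqI_degree[of "range a"])
  fix x assume "x \<in> range a"
  then obtain j where "x = a j" by blast
  then show "poly (interpolant (node_values g)) x = poly g x"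
    using node_values_interpolant[of "node_values g"]
    by (simp add: node_values_def vec_eq_iff)
qed (use assms card_coords degree_interpolant inj_a in \<open>auto simp: card_image less_Suc_eq_le\<close>)

lemma interpolant_add: "interpolant (v + w) = interpolant v + interpolant w"
  by (simp add: interpolant_def smult_add_left sum.distrib)

lemma interpolant_scale: "interpolant (c *s v) = smult c (interpolant v)"
  by (rule poly_eqI) (simp add: interpolant_def coeff_sum sum_distrib_left mult.assoc)

lemma interpolant_0 [simp]: "interpolant 0 = 0"
  by (simp add: interpolant_def)

lemma interpolant_eq_0_iff [simp]: "interpolant v = 0 \<longleftrightarrow> v = 0"
  by (metis interpolant_0 node_values_interpolant)

text \<open>The linear form whose value on a vector is the value of its interpolant at \<open>s i\<close>.\<close>

definition evaluation_form :: "nat \<Rightarrow> 'n mpoly" where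
  "evaluation_form i = linear_mpoly (\<lambda>j. poly (lagrange_basis j) (s i))"

text \<open>The linear form giving the coefficient of $x^n$ of the interpolant, also known as the divided
  difference at the nodes.\<close>

definition top_coeff_form :: "'n mpoly" where
  "top_coeff_form = linear_mpoly (\<lambda>j. coeff (lagrange_basis j) n)"

lemma peval_evaluation_form: "peval (evaluation_form i) v = poly (interpolant v) (s i)"
  by (simp add: evaluation_form_def peval_linear_mpoly interpolant_def poly_sum mult.commute)

lemma peval_top_coeff_form: "peval top_coeff_form v = coeff (interpolant v) n"
  by (simp add: top_coeff_form_def peval_linear_mpoly interpolant_def coeff_sum mult.commute)

lemma vanishes_at_evaluation_form:
  "vanishes_at (evaluation_form i) (vec.span {v}) \<longleftrightarrow> poly (interpolant v) (s i) = 0"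
  by (simp add: vanishes_at_linear_mpoly evaluation_form_def flip: peval_evaluation_form)

lemma vanishes_at_top_coeff_form:
  "vanishes_at top_coeff_form (vec.span {v}) \<longleftrightarrow> coeff (interpolant v) n = 0"
  by (simp add: vanishes_at_linear_mpoly top_coeff_form_def flip: peval_top_coeff_form)

definition root_poly :: "nat set \<Rightarrow> complex poly" where
  "root_poly J = (\<Prod>i\<in>J. [:- s i, 1:])"

lemma degree_root_poly: "degree (root_poly J) = card J"
  unfolding root_poly_def by (subst degree_prod_sum_eq) auto

lemma root_poly_nonzero [simp]: "root_poly J \<noteq> 0"
  by (cases "finite J") (auto simp: root_poly_def)

lemma poly_root_poly_eq_0_iff: "finite J \<Longrightarrow> poly (root_poly J) (s i) = 0 \<longleftrightarrow> i \<in> J"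
  using inj_s by (auto simp: root_poly_def poly_prod inj_eq)

lemma root_poly_dvd:
  assumes "finite J" "\<And>i. i \<in> J \<Longrightarrow> poly g (s i) = 0"
  shows "root_poly J dvd g"
  using assms
proof (induction J arbitrary: g rule: finite_induct)
  case empty
  then show ?case by (simp add: root_poly_def)
next
  case (insert x J)
  then obtain h where g: "g = [:- s x, 1:] * h"
    by (metis insertI1 poly_eq_0_iff_dvd dvdE)
  have "root_poly J dvd h"
  proof (rule insert.IH)
    fix i assume "i \<in> J"
    with insert.prems[of i] insert.hyps inj_s show "poly h (s i) = 0"
      by (auto simp: g inj_eq)
  qed
  then show ?case
    using insert.hyps by (simp add: g root_poly_def mult_dvd_mono del: mult_pCons_left)
qed

section \<open>The hyperplanes form a strong Hadamard set in general position\<close>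

definition vanishing_subspace :: "nat set \<Rightarrow> (complex ^ 'n) set" where
  "vanishing_subspace J = {v. \<forall>i\<in>J. poly (interpolant v) (s i) = 0}"

lemma subspace_vanishing_subspace: "vec.subspace (vanishing_subspace J)"
  by (auto simp: vec.subspace_def vanishing_subspace_def interpolant_add interpolant_scale)

text \<open>Each new root \<open>s x\<close> cuts the dimension by exactly one, since the product of the linear
  factors for \<open>J\<close> lies in the subspace for \<open>J\<close> but does not vanish at \<open>s x\<close>.\<close>

lemma dim_vanishing_subspace:
  assumes "finite J" "card J \<le> n + 1"
  shows "vec.dim (vanishing_subspace J) + card J = n + 1"
  using assms
proof (induction J rule: finite_induct)
  case empty
  have "vec.dim (UNIV :: (complex ^ 'n) set) = n + 1"
    using card_coords by (simp only: vec_dim_card)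
  then show ?case by (simp add: vanishing_subspace_def)
next
  case (insert x J)
  let ?u = "node_values (root_poly J)"
  have u: "interpolant ?u = root_poly J"
    using insert by (intro interpolant_node_values) (simp add: degree_root_poly)
  have "vec.dim (vanishing_subspace J) =
      vec.dim {v\<in>vanishing_subspace J. poly (interpolant v) (s x) = 0} + 1"
  proof (rule dim_hyperplane_section[OF subspace_vanishing_subspace])
    show "?u \<in> vanishing_subspace J" "poly (interpolant ?u) (s x) \<noteq> 0"
      using insert.hyps by (auto simp: vanishing_subspace_def u poly_root_poly_eq_0_iff)
  qed (auto simp: interpolant_add interpolant_scale)
  moreover have "{v\<in>vanishing_subspace J. poly (interpolant v) (s x) = 0}
      = vanishing_subspace (insert x J)"
    by (auto simp: vanishing_subspace_def)
  ultimately show ?case using insert by simp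
qed

lemma zero_locus_evaluation_forms:
  "zero_locus (evaluation_form ` J) = {P \<in> proj_points. P \<subseteq> vanishing_subspace J}"
  by (auto simp: zero_locus_def vanishes_at_def vanishing_subspace_def peval_evaluation_form)

text \<open>A nonempty family of lines is needed for the zero vector to lie in the union, which is why
  \<open>card J\<close> is bounded by \<open>n\<close> here.\<close>

lemma Union_zero_locus_evaluation_forms:
  assumes "finite J" "card J \<le> n"
  shows "\<Union>(zero_locus (evaluation_form ` J)) = vanishing_subspace J"
proof -
  let ?W = "vanishing_subspace J"
  have line: "vec.span {v} \<in> zero_locus (evaluation_form ` J)" if "v \<in> ?W" "v \<noteq> 0" for v
    using that vec.span_minimal[OF _ subspace_vanishing_subspace, of "{v}" J]
    by (simp add: zero_locus_evaluation_forms proj_point_span)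
  have "\<not> ?W \<subseteq> {0}"
    using dim_vanishing_subspace[OF assms(1)] assms(2) by (simp flip: vec.dim_eq_0)
  then obtain w where w: "w \<in> ?W" "w \<noteq> 0" by blast
  have "v \<in> \<Union>(zero_locus (evaluation_form ` J))" if "v \<in> ?W" for v
  proof (cases "v = 0")
    case True
    then show ?thesis using line[OF w] vec.span_zero by blast
  next
    case False
    then show ?thesis using line[OF that] vec.span_base[of v "{v}"] by blast
  qed
  then show ?thesis by (auto simp: zero_locus_evaluation_forms)
qed

lemma generally_linear_evaluation_forms: "generally_linear r evaluation_form"
  unfolding generally_linear_def
proof (intro conjI ballI allI impI)
  show "form 1 (evaluation_form i)" for i
    unfolding evaluation_form_def by (rule form_linear_mpoly)
next
  fix J assume J: "J \<subseteq> {1..r}" and c: "card J \<le> CARD('n) - 1"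
  have "finite J" using J finite_subset by blast
  then show "linear_dim (zero_locus (evaluation_form ` J)) = int (CARD('n) - 1) - int (card J)"
    using dim_vanishing_subspace[of J] c card_coords
    by (simp add: linear_dim_def Union_zero_locus_evaluation_forms)
next
  fix J assume J: "J \<subseteq> {1..r}" and c: "card J > CARD('n) - 1"
  have "v = 0" if "v \<in> vanishing_subspace J" for v
  proof -
    have "interpolant v = 0"
      using that c card_coords degree_interpolant[of v] inj_s
      by (intro poly_eqI_degree[of "s ` J"])
        (auto simp: vanishing_subspace_def card_image inj_on_subset)
    then show ?thesis by simp
  qed
  then show "zero_locus (evaluation_form ` J) = {}"
    by (auto simp: zero_locus_evaluation_forms elim!: proj_pointE)
qed

lemma hadamard_point_span:
  "hadamard_point (vec.span {v}) (vec.span {w}) = vec.span {v * w :: complex ^ 'n}"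
proof -
  have "(k *s v) * (l *s w) = (k * l) *s (v * w)" for k l
    by (simp add: vec_eq_iff)
  then show ?thesis
    unfolding hadamard_point_def vec.span_singleton
    by (auto simp: image_iff intro: exI[of _ 1]) (metis mult_1)
qed

lemma node_values_linear_nonzero: "node_values [:- s i, 1:] $ j \<noteq> 0"
  using s_neq_a[of i j] by (simp add: node_values_def)

text \<open>A polynomial of degree at most $n$ has the root $s_i$ exactly when it is $x - s_i$ times a
  polynomial of degree less than $n$. As this is an equality of sets before taking any closure, the
  products already form a Zariski closed set.\<close>

lemma zero_locus_evaluation_form_eq_hadamard:
  "zero_locus {evaluation_form i} =
    {hadamard_point (vec.span {node_values [:- s i, 1:]}) Q | Q. Q \<in> zero_locus {top_coeff_form} \<and>
      hadamard_defined (vec.span {node_values [:- s i, 1:]}) Q}"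
    (is "?Z = {hadamard_point (vec.span {?p}) Q | Q. _ \<and> _}")
proof (intro equalityI subsetI)
  note p_nz = node_values_linear_nonzero[of i]
  {
    fix R assume R: "R \<in> ?Z"
    then obtain c where c: "c \<noteq> 0" "R = vec.span {c}"
      by (auto simp: zero_locus_def elim: proj_pointE)
    with R have "poly (interpolant c) (s i) = 0"
      by (simp add: zero_locus_def vanishes_at_evaluation_form)
    then obtain h where h: "interpolant c = [:- s i, 1:] * h"
      by (metis poly_eq_0_iff_dvd dvdE)
    have h0: "h \<noteq> 0" using c h by auto
    then have "degree (interpolant c) = degree h + 1"
      unfolding h by (subst degree_mult_eq) auto
    then have deg: "degree h < n" using degree_interpolant[of c] by simp
    let ?q = "node_values h"
    have pq: "?p * ?q = c"
      by (metis h node_values_mult node_values_interpolant)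
    have "?q \<noteq> 0" using c pq by auto
    then obtain j where j: "?q $ j \<noteq> 0" by (auto simp: vec_eq_iff)
    have "vec.span {?q} \<in> zero_locus {top_coeff_form}"
      using \<open>?q \<noteq> 0\<close> deg
      by (simp add: zero_locus_def proj_point_span vanishes_at_top_coeff_form coeff_eq_0)
    moreover have "hadamard_defined (vec.span {?p}) (vec.span {?q})"
      unfolding hadamard_defined_def
      by (intro bexI[of _ ?p] bexI[of _ ?q] exI[of _ j])
        (use j p_nz in \<open>auto intro: vec.span_base\<close>)
    moreover have "R = hadamard_point (vec.span {?p}) (vec.span {?q})"
      by (simp only: hadamard_point_span pq c)
    ultimately show "R \<in> {hadamard_point (vec.span {?p}) Q | Q. Q \<in> zero_locus {top_coeff_form} \<and>
        hadamard_defined (vec.span {?p}) Q}" by blast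
  next
    fix R assume "R \<in> {hadamard_point (vec.span {?p}) Q | Q. Q \<in> zero_locus {top_coeff_form} \<and>
        hadamard_defined (vec.span {?p}) Q}"
    then obtain Q where Q: "Q \<in> zero_locus {top_coeff_form}"
      and R: "R = hadamard_point (vec.span {?p}) Q" by blast
    from Q obtain q where q: "q \<noteq> 0" "Q = vec.span {q}"
      by (auto simp: zero_locus_def elim: proj_pointE)
    have "coeff (interpolant q) n = 0"
      using Q q by (simp add: zero_locus_def vanishes_at_top_coeff_form)
    have "degree (interpolant q) \<noteq> n"
      using \<open>coeff (interpolant q) n = 0\<close> q by (metis interpolant_eq_0_iff leading_coeff_0_iff)
    with degree_interpolant[of q] have "degree (interpolant q) < n" by simp
    then have "degree ([:- s i, 1:] * interpolant q) \<le> n"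
      using degree_mult_le[of "[:- s i, 1:]" "interpolant q"] by simp
    then have "interpolant (?p * q) = [:- s i, 1:] * interpolant q"
      by (metis interpolant_node_values node_values_mult node_values_interpolant)
    moreover have "?p * q \<noteq> 0"
      using q p_nz by (auto simp: vec_eq_iff)
    moreover have "R = vec.span {?p * q}"
      by (simp only: R q hadamard_point_span)
    ultimately show "R \<in> ?Z"
      by (simp add: zero_locus_def proj_point_span vanishes_at_evaluation_form)
  }
qed

lemma strong_hadamard_evaluation_forms:
  assumes "n \<ge> 2"
  shows "strong_hadamard r evaluation_form"
  unfolding strong_hadamard_def
proof (intro exI conjI ballI)
  let ?P = "\<lambda>i. vec.span {node_values [:- s i, 1:]}"
  show "form 1 top_coeff_form"
    unfolding top_coeff_form_def by (rule form_linear_mpoly)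
  have "peval top_coeff_form (node_values (monom 1 n)) = 1"
    by (simp add: peval_top_coeff_form degree_monom_le)
  then show "top_coeff_form \<noteq> 0" by (auto simp: peval_def)
  fix i
  have "node_values [:- s i, 1:] \<noteq> 0"
    by (metis node_values_linear_nonzero zero_index)
  moreover have "coeff (interpolant (node_values [:- s i, 1:])) n = 0"
    using assms by (simp add: coeff_eq_0)
  ultimately show "?P i \<in> zero_locus {top_coeff_form}"
    by (simp add: zero_locus_def proj_point_span vanishes_at_top_coeff_form)
  have "form 1 (evaluation_form i)"
    unfolding evaluation_form_def by (rule form_linear_mpoly)
  then have "zariski_closed (zero_locus {evaluation_form i})"
    unfolding zariski_closed_def by blast
  then show "zero_locus {evaluation_form i} = hadamard_variety (?P i) (zero_locus {top_coeff_form})"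
    unfolding hadamard_variety_def
    by (simp only: zero_locus_evaluation_form_eq_hadamard[symmetric] hull_same)
qed

section \<open>Forms vanishing on the star configuration\<close>

abbreviation star :: "nat \<Rightarrow> (complex ^ 'n) set set" where
  "star r \<equiv> star_configuration r (\<lambda>i. zero_locus {evaluation_form i})"

lemma vanishing_subspace_proj_point:
  "finite J \<Longrightarrow> card J = n \<Longrightarrow> vanishing_subspace J \<in> proj_points"
  using dim_vanishing_subspace[of J] subspace_vanishing_subspace by (simp add: proj_points_def)

lemma star_eq:
  assumes "n \<ge> 1"
  shows "star r = vanishing_subspace ` {J. J \<subseteq> {1..r} \<and> card J = n}"
proof -
  have "(\<Inter>i\<in>J. zero_locus {evaluation_form i}) = {vanishing_subspace J}"
    if J: "J \<subseteq> {1..r}" "card J = n" for J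
  proof -
    have fin: "finite J" using J finite_subset by blast
    have W: "vanishing_subspace J \<in> proj_points"
      using fin J(2) by (rule vanishing_subspace_proj_point)
    have point: "P = vanishing_subspace J" if "P \<in> proj_points" "P \<subseteq> vanishing_subspace J" for P
      using that W by (intro vec.subspace_dim_equal) (auto simp: proj_points_def)
    have "J \<noteq> {}" using J assms by auto
    then have "(\<Inter>i\<in>J. zero_locus {evaluation_form i}) = zero_locus (evaluation_form ` J)"
      by (auto simp: zero_locus_def)
    also have "\<dots> = {P \<in> proj_points. P \<subseteq> vanishing_subspace J}"
      by (rule zero_locus_evaluation_forms)
    also have "\<dots> = {vanishing_subspace J}"
      using W point by auto
    finally show ?thesis .
  qed
  then show ?thesis
    using card_coords by (auto simp: star_configuration_def)
qed

text \<open>The induction is on the number \<open>n - card J\<close> of roots that have been set free. If \<open>g\<close> has degree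
  \<open>n\<close>, then dividing it by the linear factors for \<open>J\<close> leaves a polynomial with a root \<open>z\<close>, and this
  root is moved to the unused \<open>s i\<close>. A polynomial of smaller degree may have no root to spare; it
  has one at infinity instead, which the extra factor $1 + t (x - a)$, with a node $a$, moves.\<close>

lemma form_vanishing_on_star:
  assumes f: "form e f" "\<And>P. P \<in> star r \<Longrightarrow> vanishes_at f P" and n: "n \<ge> 1" and e: "e + n \<le> r"
  assumes J: "J \<subseteq> {1..r}" "card J \<le> n" and g: "degree g \<le> n" "\<And>i. i \<in> J \<Longrightarrow> poly g (s i) = 0"
  shows "peval f (node_values g) = 0"
  using J g
proof (induction "n - card J" arbitrary: J g)
  case 0
  then have "vanishing_subspace J \<in> star r" by (auto simp: star_eq[OF n])
  moreover have "node_values g \<in> vanishing_subspace J"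
    using 0 by (simp add: vanishing_subspace_def)
  ultimately show ?case using f(2) by (auto simp: vanishes_at_def)
next
  case (Suc k)
  have fin: "finite J" using Suc.prems finite_subset by blast
  let ?I = "{1..r} - J"
  have card_I: "e < card ?I"
    using Suc.prems Suc.hyps(2) e fin by (simp add: card_Diff_subset)
  have IH: "peval f (node_values (q * g')) = 0"
    if "degree g' < n" "degree q \<le> 1" "\<And>i. i \<in> J \<Longrightarrow> poly g' (s i) = 0"
      and i: "i \<in> ?I" "poly q (s i) = 0" for g' q i
  proof (rule Suc.hyps(1)[of "insert i J"])
    show "k = n - card (insert i J)" "card (insert i J) \<le> n"
      using Suc.hyps(2) i fin by auto
    show "degree (q * g') \<le> n"
      using degree_mult_le[of q g'] that by simp
  qed (use that Suc.prems in auto)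
  show ?case
  proof (cases "degree g < n")
    case True
    \<comment> \<open>Any number distinct from all \<open>s i\<close> would do; at \<open>t = 0\<close> the pencil passes through \<open>g\<close>, and
      at the listed parameters the extra factor vanishes at \<open>s i\<close>.\<close>
    define a0 where "a0 = a undefined"
    have s_neq_a0: "s i \<noteq> a0" for i using s_neq_a by (simp add: a0_def)
    let ?T = "(\<lambda>i. - 1 / (s i - a0)) ` ?I"
    have "inj_on (\<lambda>i. - 1 / (s i - a0)) ?I"
      using inj_s s_neq_a0 by (intro inj_onI) (auto simp: inj_eq)
    then have card_T: "e < card ?T" using card_I by (simp add: card_image)
    have "peval f (node_values g + t *s node_values ([:- a0, 1:] * g)) = 0" if "t \<in> ?T" for t
    proof -
      from that obtain i where i: "i \<in> ?I" "t = - 1 / (s i - a0)" by blast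
      have "peval f (node_values ((1 + smult t [:- a0, 1:]) * g)) = 0"
        using True Suc.prems(4) i s_neq_a0[of i]
        by (intro IH[of g _ i]) (auto simp: field_simps intro: degree_add_le)
      also have "(1 + smult t [:- a0, 1:]) * g = g + smult t ([:- a0, 1:] * g)"
        by (simp only: distrib_right mult_1 mult_smult_left)
      finally show ?thesis by (simp only: node_values_smult node_values_add)
    qed
    from peval_zero_from_pencil[OF f(1) _ card_T this, of 0] show ?thesis by simp
  next
    case False
    then have deg: "degree g = n" using Suc.prems by simp
    obtain h where h: "g = root_poly J * h"
      using root_poly_dvd[OF fin] Suc.prems(4) by (metis dvdE)
    have "h \<noteq> 0" using deg h n by auto
    then have "degree g = card J + degree h"
      unfolding h by (simp add: degree_mult_eq degree_root_poly)
    then have "\<not> constant (poly h)"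
      using deg Suc.hyps(2) by (simp add: constant_degree)
    then obtain z where "poly h z = 0" using fundamental_theorem_of_algebra by blast
    then obtain h' where h': "h = [:- z, 1:] * h'"
      by (metis poly_eq_0_iff_dvd dvdE)
    \<comment> \<open>The pencil \<open>(x - t) * ?g\<close> passes through \<open>g\<close> at \<open>t = z\<close>.\<close>
    let ?g = "root_poly J * h'"
    have g_eq: "g = [:- z, 1:] * ?g" by (simp only: h h' mult_ac)
    then have "degree g = 1 + degree ?g"
      using \<open>h \<noteq> 0\<close> h' by (subst g_eq, subst degree_mult_eq) auto
    then have deg': "degree ?g < n" using deg by simp
    have card_T: "e < card (s ` ?I)"
      using card_I inj_s by (simp add: card_image inj_on_subset)
    have line: "[:- t, 1:] * ?g = [:0, 1:] * ?g + smult (- t) ?g" for t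
      by simp
    have "peval f (node_values ([:0, 1:] * ?g) + t *s node_values (- ?g)) = 0" if "t \<in> s ` ?I" for t
    proof -
      from that obtain i where i: "i \<in> ?I" "t = s i" by blast
      have "peval f (node_values ([:- t, 1:] * ?g)) = 0"
        using deg' i fin by (intro IH[of ?g _ i]) (auto simp: poly_root_poly_eq_0_iff)
      then show ?thesis unfolding line
        by (simp flip: node_values_smult node_values_add)
    qed
    from peval_zero_from_pencil[OF f(1) _ card_T this, of z] show ?thesis
      unfolding g_eq line by (simp flip: node_values_smult node_values_add)
  qed
qed

lemma form_vanishing_on_star_eq_0:
  assumes "form e f" "\<forall>P\<in>star r. vanishes_at f P" "n \<ge> 1" "e + n \<le> r"
  shows "f = 0"
proof (rule peval_eq_0_imp_eq_0)
  fix v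
  have "peval f (node_values (interpolant v)) = 0"
    using assms degree_interpolant[of v] by (intro form_vanishing_on_star[of e f r "{}"]) auto
  then show "peval f v = 0" by simp
qed

lemma hadamard_star_configuration_star:
  "n \<ge> 2 \<Longrightarrow> hadamard_star_configuration r (star r)"
  unfolding hadamard_star_configuration_def
  using generally_linear_evaluation_forms strong_hadamard_evaluation_forms by blast

lemma apolar_star:
  assumes "form d F" "n \<ge> 1" "r \<ge> d + n"
  shows "apolar (star r) F"
  unfolding apolar_def
proof (intro conjI)
  show "finite (star r)" using assms by (simp add: star_eq)
  show "star r \<subseteq> proj_points"
    using assms by (auto simp: star_eq intro!: vanishing_subspace_proj_point intro: finite_subset)
  show "vanishing_ideal (star r) \<subseteq> perp F"
    by (rule vanishing_ideal_subset_perp[OF assms(1)], erule form_vanishing_on_star_eq_0)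
      (use assms in auto)
qed

end

section \<open>Every form has apolar Hadamard star configurations\<close>

theorem lemma5p5:
  fixes F :: "('n::finite) mpoly" and n d r :: nat
  assumes "CARD('n) = n + 1" and "n \<ge> 2"
    and "d \<ge> 2" and "form d F"
    and "r \<ge> d + n"
  shows "\<exists>X :: (complex ^ 'n) set set. hadamard_star_configuration r X \<and> apolar X F"
proof -
  \<comment> \<open>Distinct natural numbers serve as nodes, the negative integers as the \<open>s i\<close>.\<close>
  obtain idx :: "'n \<Rightarrow> nat" where idx: "inj idx"
    using finite_imp_inj_to_nat_seg[of "UNIV :: 'n set"] by auto
  interpret interpolation_model "\<lambda>j. of_nat (idx j)" "\<lambda>i. - of_nat (Suc i)" n
  proof
    show "inj (\<lambda>j. of_nat (idx j) :: complex)" using idx by (auto simp: inj_def)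
    show "inj (\<lambda>i. - of_nat (Suc i) :: complex)" by (auto simp: inj_def)
    show "- of_nat (Suc i) \<noteq> (of_nat (idx j) :: complex)" for i j
    proof
      assume "- of_nat (Suc i) = (of_nat (idx j) :: complex)"
      then have "of_nat (Suc i + idx j) = (0 :: complex)"
        by (metis neg_eq_iff_add_eq_0 of_nat_add)
      then show False by (simp only: of_nat_eq_0_iff)
    qed
  qed (rule assms(1))
  show ?thesis
    using hadamard_star_configuration_star[of r] apolar_star[of d F r] assms by auto
qed

end
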